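(* Let $\alpha\in\mathbb{R}\setminus\{0\}$ and let $M$ be a $K^{\alpha}$-translator with speed $w$. If $M$ is a canal surface, then the spine (center) curve of $M$ is a straight line. Thus $M$ is a surface of revolution which (in suitable Euclidean coordinates, with the spine line suitably oriented) is parametrized by $$X(s,\theta)=\big(r(s)\sin\varphi(s)\cos\theta,\ r(s)\sin\varphi(s)\sin\theta,\ r(s)\cos\varphi(s)+s\big),$$ where $r'(s)=-\cos\varphi(s)$ and the radius function $r(s)$ satisfies $$\left(\frac{r''}{r(rr''-1+r'^2)}\right)^{\alpha}=-r',$$ and $w$ equals the tangent vector of the spine (center) curve.
   Context: A canal surface $M$ in $\mathbb{E}^3$ is a regular surface parametrized by $$X(s,\theta)=c(s)+r(s)\big(\sin\varphi\cos\theta\,N+\sin\varphi\sin\theta\,B+\cos\varphi\,T\big),\qquad s\in[0,\ell],\ \theta\in[0,2\pi),$$ where $c(s)$ (the spine or center curve) is a unit-speed curve of length $\ell$ with Frenet frame $\{T,N,B\}$ satisfying $T'=\kappa N$, $N'=-\kappa T+\tau B$, $B'=-\tau N$ (for a straight line, $\kappa=0$ and $\{T,N,B\}$ is a constant orthonormal frame with $T$ tangent to the line), $r(s)>0$ is the radial function, and $\varphi=\varphi(s)$ is a smooth function with $r'(s)=-\cos\varphi(s)$. Its unit normal is taken to be $U=\cos\varphi\,T+\sin\varphi\cos\theta\,N+\sin\varphi\sin\theta\,B$, and its Gauss curvature is $K=\frac{Q}{rP}$ with $P=rr''+r\kappa\sin\varphi\cos\theta-\sin^2\varphi$ and $Q=r''+\kappa\sin\varphi\cos\theta$.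 For a constant $\alpha\neq0$, a surface with Gauss curvature $K$ and unit normal $U$ is a $K^{\alpha}$-translator with speed $w$, where $w\in\mathbb{R}^3$ is a constant unit vector, if $K^{\alpha}=\langle U,w\rangle$ everywhere on the surface. The Gauss curvature of a translator is assumed nowhere zero, and $K^{\alpha}$ must be a well-defined real number: powers of negative numbers are used only for integer exponents. *)

theory Defs
  imports "HOL-Analysis.Analysis"
begin

section \<open>Real powers\<close>

text \<open>
  Negative bases are admitted for integer exponents only; the base \<open>0\<close> is excluded.
  The function \<open>rpow\<close> is only meaningful where \<open>rpow_defined\<close> holds.
\<close>

definition rpow_defined :: "real \<Rightarrow> real \<Rightarrow> bool" where
  "rpow_defined x a \<longleftrightarrow> 0 < x \<or> (x < 0 \<and> a \<in> \<int>)"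

definition rpow :: "real \<Rightarrow> real \<Rightarrow> real" where
  "rpow x a = (if a \<in> \<int> then x powi \<lfloor>a\<rfloor> else x powr a)"


section \<open>Curves and parametrized surfaces\<close>

text \<open>Derivatives at the end points of a closed interval are one-sided.\<close>

definition smooth_on :: "real set \<Rightarrow> (real \<Rightarrow> 'a::real_normed_vector) \<Rightarrow> bool" where
  "smooth_on I f \<longleftrightarrow>
     (\<exists>D. (\<forall>s\<in>I. D 0 s = f s) \<and>
          (\<forall>n::nat. \<forall>s\<in>I. (D n has_vector_derivative D (Suc n) s) (at s within I)))"

abbreviation deriv_on :: "real set \<Rightarrow> (real \<Rightarrow> 'a::real_normed_vector) \<Rightarrow> real \<Rightarrow> 'a" where
  "deriv_on I f s \<equiv> vector_derivative f (at s within I)"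

definition pd1 :: "real set \<Rightarrow> (real \<Rightarrow> real \<Rightarrow> real^3) \<Rightarrow> real \<Rightarrow> real \<Rightarrow> real^3" where
  "pd1 I X s \<theta> = deriv_on I (\<lambda>t. X t \<theta>) s"

definition pd2 :: "real set \<Rightarrow> (real \<Rightarrow> real \<Rightarrow> real^3) \<Rightarrow> real \<Rightarrow> real \<Rightarrow> real^3" where
  "pd2 J X s \<theta> = deriv_on J (\<lambda>t. X s t) \<theta>"

definition regular_patch :: "real set \<Rightarrow> real set \<Rightarrow> (real \<Rightarrow> real \<Rightarrow> real^3) \<Rightarrow> bool" where
  "regular_patch I J X \<longleftrightarrow>
     (\<forall>s\<in>I. \<forall>\<theta>\<in>J. cross3 (pd1 I X s \<theta>) (pd2 J X s \<theta>) \<noteq> 0)"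

definition unit_normal ::
    "real set \<Rightarrow> real set \<Rightarrow> (real \<Rightarrow> real \<Rightarrow> real^3) \<Rightarrow> (real \<Rightarrow> real \<Rightarrow> real^3) \<Rightarrow> bool" where
  "unit_normal I J X U \<longleftrightarrow>
     (\<forall>s\<in>I. \<forall>\<theta>\<in>J. norm (U s \<theta>) = 1 \<and>
        U s \<theta> \<bullet> pd1 I X s \<theta> = 0 \<and> U s \<theta> \<bullet> pd2 J X s \<theta> = 0)"

text \<open>
  The Gauss curvature is the determinant of the shape operator \<open>-dU\<close>, i.e. the quotient of the
  determinants of the second and the first fundamental form. The coefficients of the second form
  are \<open>-\<langle>U\<^sub>i, X\<^sub>j\<rangle>\<close>; the signs cancel in the determinant.
\<close>

definition gauss_curvature ::
    "real set \<Rightarrow> real set \<Rightarrow> (real \<Rightarrow> real \<Rightarrow> real^3) \<Rightarrow> (real \<Rightarrow> real \<Rightarrow> real^3) \<Rightarrow> real \<Rightarrow> real \<Rightarrow> real" where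
  "gauss_curvature I J X U s \<theta> =
     (let Xs = pd1 I X s \<theta>; Xt = pd2 J X s \<theta>; Us = pd1 I U s \<theta>; Ut = pd2 J U s \<theta>
      in ((Us \<bullet> Xs) * (Ut \<bullet> Xt) - (Us \<bullet> Xt) * (Ut \<bullet> Xs)) /
         ((Xs \<bullet> Xs) * (Xt \<bullet> Xt) - (Xs \<bullet> Xt)\<^sup>2))"

definition K_translator ::
    "real \<Rightarrow> real^3 \<Rightarrow> real set \<Rightarrow> real set \<Rightarrow>
     (real \<Rightarrow> real \<Rightarrow> real^3) \<Rightarrow> (real \<Rightarrow> real \<Rightarrow> real^3) \<Rightarrow> bool" where
  "K_translator \<alpha> w I J X U \<longleftrightarrow>
     unit_normal I J X U \<and>
     (\<forall>s\<in>I. \<forall>\<theta>\<in>J.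
        rpow_defined (gauss_curvature I J X U s \<theta>) \<alpha> \<and>
        rpow (gauss_curvature I J X U s \<theta>) \<alpha> = U s \<theta> \<bullet> w)"


section \<open>Canal surfaces\<close>

text \<open>
  The functions \<open>\<kappa>\<close> and \<open>\<tau>\<close> are not subject to a sign condition and the frame may have either
  orientation. If the curve is a straight line, the frame is required to be constant.
\<close>

definition frenet_frame ::
    "real set \<Rightarrow> (real \<Rightarrow> real^3) \<Rightarrow> (real \<Rightarrow> real^3) \<Rightarrow> (real \<Rightarrow> real^3) \<Rightarrow> (real \<Rightarrow> real^3) \<Rightarrow>
     (real \<Rightarrow> real) \<Rightarrow> (real \<Rightarrow> real) \<Rightarrow> bool" where
  "frenet_frame I c T N B \<kappa> \<tau> \<longleftrightarrow>
     (\<forall>s\<in>I.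
        norm (T s) = 1 \<and> norm (N s) = 1 \<and> norm (B s) = 1 \<and>
        T s \<bullet> N s = 0 \<and> T s \<bullet> B s = 0 \<and> N s \<bullet> B s = 0 \<and>
        (c has_vector_derivative T s) (at s within I) \<and>
        (T has_vector_derivative \<kappa> s *\<^sub>R N s) (at s within I) \<and>
        (N has_vector_derivative - \<kappa> s *\<^sub>R T s + \<tau> s *\<^sub>R B s) (at s within I) \<and>
        (B has_vector_derivative - \<tau> s *\<^sub>R N s) (at s within I)) \<and>
     ((\<forall>s\<in>I. \<kappa> s = 0) \<longrightarrow> (\<forall>s\<in>I. \<forall>t\<in>I. T s = T t \<and> N s = N t \<and> B s = B t))"

definition canal_normal ::
    "(real \<Rightarrow> real) \<Rightarrow> (real \<Rightarrow> real^3) \<Rightarrow> (real \<Rightarrow> real^3) \<Rightarrow> (real \<Rightarrow> real^3) \<Rightarrow> real \<Rightarrow> real \<Rightarrow> real^3" where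
  "canal_normal \<phi> T N B s \<theta> =
     cos (\<phi> s) *\<^sub>R T s + (sin (\<phi> s) * cos \<theta>) *\<^sub>R N s + (sin (\<phi> s) * sin \<theta>) *\<^sub>R B s"

definition canal_param ::
    "(real \<Rightarrow> real^3) \<Rightarrow> (real \<Rightarrow> real) \<Rightarrow> (real \<Rightarrow> real) \<Rightarrow>
     (real \<Rightarrow> real^3) \<Rightarrow> (real \<Rightarrow> real^3) \<Rightarrow> (real \<Rightarrow> real^3) \<Rightarrow> real \<Rightarrow> real \<Rightarrow> real^3" where
  "canal_param c r \<phi> T N B s \<theta> =
     c s + r s *\<^sub>R ((sin (\<phi> s) * cos \<theta>) *\<^sub>R N s + (sin (\<phi> s) * sin \<theta>) *\<^sub>R B s + cos (\<phi> s) *\<^sub>R T s)"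

definition canal_surface ::
    "real \<Rightarrow> (real \<Rightarrow> real^3) \<Rightarrow> (real \<Rightarrow> real) \<Rightarrow> (real \<Rightarrow> real) \<Rightarrow>
     (real \<Rightarrow> real^3) \<Rightarrow> (real \<Rightarrow> real^3) \<Rightarrow> (real \<Rightarrow> real^3) \<Rightarrow>
     (real \<Rightarrow> real) \<Rightarrow> (real \<Rightarrow> real) \<Rightarrow> bool" where
  "canal_surface l c r \<phi> T N B \<kappa> \<tau> \<longleftrightarrow>
     0 < l \<and>
     smooth_on {0..l} c \<and> smooth_on {0..l} r \<and> smooth_on {0..l} \<phi> \<and>
     smooth_on {0..l} T \<and> smooth_on {0..l} N \<and> smooth_on {0..l} B \<and>
     frenet_frame {0..l} c T N B \<kappa> \<tau> \<and>
     (\<forall>s\<in>{0..l}. 0 < r s \<and> (r has_vector_derivative - cos (\<phi> s)) (at s within {0..l})) \<and>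
     regular_patch {0..l} {0..<2*pi} (canal_param c r \<phi> T N B)"

text \<open>
  The same spine data, possibly traversed in the opposite direction. Reversal replaces \<open>\<phi>\<close> by
  \<open>\<pi> - \<phi>\<close> because \<open>r'\<close> changes sign.
\<close>

definition reoriented ::
    "real \<Rightarrow> (real \<Rightarrow> real^3) \<Rightarrow> (real \<Rightarrow> real) \<Rightarrow> (real \<Rightarrow> real) \<Rightarrow> (real \<Rightarrow> real) \<Rightarrow>
     (real \<Rightarrow> real^3) \<Rightarrow> (real \<Rightarrow> real) \<Rightarrow> (real \<Rightarrow> real) \<Rightarrow> bool" where
  "reoriented l c r \<phi> \<sigma> c\<^sub>1 r\<^sub>1 \<phi>\<^sub>1 \<longleftrightarrow>
     (\<sigma> = (\<lambda>s. s) \<and> c\<^sub>1 = c \<and> r\<^sub>1 = r \<and> \<phi>\<^sub>1 = \<phi>) \<or>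
     (\<sigma> = (\<lambda>s. l - s) \<and> c\<^sub>1 = (\<lambda>s. c (l - s)) \<and> r\<^sub>1 = (\<lambda>s. r (l - s)) \<and>
      \<phi>\<^sub>1 = (\<lambda>s. pi - \<phi> (l - s)))"

definition revolution_param :: "(real \<Rightarrow> real) \<Rightarrow> (real \<Rightarrow> real) \<Rightarrow> real \<Rightarrow> real \<Rightarrow> real^3" where
  "revolution_param r \<phi> s \<theta> =
     vector [r s * sin (\<phi> s) * cos \<theta>, r s * sin (\<phi> s) * sin \<theta>, r s * cos (\<phi> s) + s]"

text \<open>
  The left-hand side of the equation for the radius function has to be a well-defined power;
  in particular its base, and hence the denominator in it, is nonzero.
\<close>

definition radius_equation :: "real \<Rightarrow> real set \<Rightarrow> (real \<Rightarrow> real) \<Rightarrow> bool" where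
  "radius_equation \<alpha> I r \<longleftrightarrow>
     (\<forall>s\<in>I.
        let r' = deriv_on I r s; r'' = deriv_on I (deriv_on I r) s;
            q = r'' / (r s * (r s * r'' - 1 + r'\<^sup>2))
        in rpow_defined q \<alpha> \<and> rpow q \<alpha> = - r')"

end

theory Submission
  imports Defs
begin

text \<open>
  The whole argument takes place on one circle of the canal surface at a time: at fixed \<open>s\<close> the
  translator equation is an identity between functions of \<open>\<theta>\<close>, and it is rigid enough to force
  \<open>\<kappa> s = 0\<close>.

  The point \<open>X\<close> is \<open>c + r U\<close>, so the tangential parts of \<open>dX\<close> are those of \<open>dc\<close> plus \<open>r dU\<close>, and in an
  orthonormal basis of the tangent plane the curvature comes out as
  \<open>K = (p + \<kappa> x) / (r (r (p + \<kappa> x) - sin \<phi>))\<close> with \<open>x = cos \<theta>\<close> and \<open>p = \<phi>'\<close> (lemma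
  \<open>gauss_curvature_canal\<close>). Multiplying numerator and denominator by \<open>sin \<phi>\<close> and using
  \<open>r'' = p sin \<phi>\<close> gives the usual form \<open>Q / (r P)\<close>. Regularity of the surface means in particular
  \<open>sin \<phi> \<noteq> 0\<close>.

  Now \<open>K\<close> depends on \<open>\<theta>\<close> only through \<open>x\<close>, whereas \<open>\<langle>U, w\<rangle>\<close> has the term
  \<open>sin \<phi> sin \<theta> \<langle>B, w\<rangle>\<close>, which is odd under \<open>\<theta> \<mapsto> 2\<pi> - \<theta>\<close>; hence \<open>\<langle>B, w\<rangle> = 0\<close>, and
  \<open>K\<^sup>\<alpha> = A + C x\<close> for \<open>-1 < x < 1\<close>. If \<open>\<kappa> \<noteq> 0\<close>, then \<open>K\<close> is a nonconstant linear fractional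
  function of \<open>x\<close> that has both a finite zero and a finite pole. Comparing logarithmic derivatives of
  the two sides gives the polynomial identity
  \<open>C (p + \<kappa> x) (r (p + \<kappa> x) - sin \<phi>) = - \<alpha> \<kappa> sin \<phi> (A + C x)\<close>, whose coefficient at \<open>x\<^sup>2\<close> forces
  \<open>C = 0\<close>, after which the right side would have to vanish although \<open>A = K\<^sup>\<alpha>\<close> does not
  (lemma \<open>rpow_moebius_not_affine\<close>). So \<open>\<kappa> = 0\<close>.

  With \<open>\<kappa> = 0\<close> everywhere the frame is constant and the spine is a line. The curvature no longer
  depends on \<open>\<theta>\<close>, so comparing \<open>\<theta> = 0\<close> with \<open>\<theta> = \<pi>\<close> gives \<open>\<langle>N, w\<rangle> = 0\<close> too, and \<open>w = \<plusminus>T\<close>.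
  If \<open>w = -T\<close>, the spine is traversed backwards. In both cases \<open>K\<^sup>\<alpha> = \<langle>U, w\<rangle>\<close> is exactly the equation
  for the radius function.
\<close>

section \<open>Derivatives on intervals\<close>

text \<open>
  A point of a connected set with another point in it is a limit point, so one-sided derivatives at the
  ends of an interval are determined as well.
\<close>

lemma vector_derivative_within_connected:
  fixes f :: "real \<Rightarrow> 'a::real_normed_vector"
  assumes "(f has_vector_derivative f') (at x within S)" "connected S" "x \<in> S" "y \<in> S" "y \<noteq> x"
  shows "vector_derivative f (at x within S) = f'"
proof -
  have "x islimpt S"
    using assms by (intro connected_imp_perfect) auto
  then have "at x within S \<noteq> bot"
    by (simp add: trivial_limit_within)
  then show ?thesis
    using assms(1) vector_derivative_unique_within vector_derivative_works
      differentiableI_vector by blast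
qed

lemma deriv_on_Icc:
  fixes f :: "real \<Rightarrow> 'a::real_normed_vector"
  assumes "(f has_vector_derivative f') (at s within {0..l})" "0 < l" "s \<in> {0..l}"
  shows "deriv_on {0..l} f s = f'"
proof (cases "s = 0")
  case True
  show ?thesis
    using assms True by (intro vector_derivative_within_connected[of _ _ _ _ l]) auto
next
  case False
  show ?thesis
    using assms False by (intro vector_derivative_within_connected[of _ _ _ _ 0]) auto
qed

lemma deriv_on_Ico_2pi:
  fixes f :: "real \<Rightarrow> 'a::real_normed_vector"
  assumes "(f has_vector_derivative f') (at \<theta> within {0..<2*pi})" "\<theta> \<in> {0..<2*pi}"
  shows "deriv_on {0..<2*pi} f \<theta> = f'"
proof (cases "\<theta> = 0")
  case True
  show ?thesis
    using assms True by (intro vector_derivative_within_connected[of _ _ _ _ pi]) auto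
next
  case False
  show ?thesis
    using assms False by (intro vector_derivative_within_connected[of _ _ _ _ 0]) auto
qed

lemma smooth_on_has_derivative:
  assumes "smooth_on I f" "s \<in> I"
  obtains f' where "(f has_vector_derivative f') (at s within I)"
proof -
  obtain D where D: "\<And>s. s \<in> I \<Longrightarrow> D 0 s = f s"
    "\<And>n s. s \<in> I \<Longrightarrow> (D n has_vector_derivative D (Suc n) s) (at s within I)"
    using assms(1) unfolding smooth_on_def by metis
  have "(f has_vector_derivative D (Suc 0) s) (at s within I)"
    by (rule has_vector_derivative_transform[OF assms(2) _ D(2)[OF assms(2)]]) (simp add: D(1))
  then show ?thesis by (rule that)
qed


section \<open>Powers of linear fractional functions\<close>

text \<open>
  Passing to absolute values removes the case distinction between real and integer exponents, and makes
  logarithms available for negative bases.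
\<close>

lemma abs_rpow: "rpow_defined x a \<Longrightarrow> \<bar>rpow x a\<bar> = \<bar>x\<bar> powr a"
  by (auto simp: rpow_def rpow_defined_def power_int_abs powr_real_of_int' elim!: Ints_cases)

text \<open>
  The logarithm of the square is a form of \<open>2 ln \<bar>f\<bar>\<close> that is differentiable whatever the sign of
  \<open>f\<close>.
\<close>

lemma DERIV_ln_square:
  fixes f :: "real \<Rightarrow> real"
  assumes "(f has_real_derivative f') (at x)" "f x \<noteq> 0"
  shows "((\<lambda>x. ln ((f x)\<^sup>2)) has_real_derivative 2 * f' / f x) (at x)"
proof -
  have "((\<lambda>x. (f x)\<^sup>2) has_real_derivative 2 * f x * f') (at x)"
    by (auto intro!: derivative_eq_intros assms)
  then have "((\<lambda>x. ln ((f x)\<^sup>2)) has_real_derivative 1 / (f x)\<^sup>2 * (2 * f x * f')) (at x)"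
    using assms(2) by (intro DERIV_chain2[OF DERIV_ln_divide]) auto
  moreover have "1 / (f x)\<^sup>2 * (2 * f x * f') = 2 * f' / f x"
    using assms(2) by (simp add: power2_eq_square)
  ultimately show ?thesis by simp
qed

text \<open>
  The zero and the pole of the linear fractional function are distinct because \<open>S \<noteq> 0\<close>, and both are
  finite because \<open>\<kappa> \<noteq> 0\<close> and \<open>r \<noteq> 0\<close>. Its logarithmic derivative therefore has two finite poles,
  while that of an affine function has at most one. The proof clears denominators, which turns this
  into a comparison of a quadratic polynomial with an affine one.
\<close>

lemma rpow_moebius_not_affine:
  fixes \<alpha> r \<kappa> S u A C :: real
  assumes "\<alpha> \<noteq> 0" "r \<noteq> 0" "\<kappa> \<noteq> 0" "S \<noteq> 0"
    and "\<And>x. -1 < x \<Longrightarrow> x < 1 \<Longrightarrow>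
           rpow_defined ((u + \<kappa> * x) / (r * (r * (u + \<kappa> * x) - S))) \<alpha> \<and>
           rpow ((u + \<kappa> * x) / (r * (r * (u + \<kappa> * x) - S))) \<alpha> = A + C * x"
  shows False
proof -
  define f where "f x = (u + \<kappa> * x) / (r * (r * (u + \<kappa> * x) - S))" for x
  define n where "n x = u + \<kappa> * x" for x
  define d where "d x = r * n x - S" for x
  define q where "q x = A + C * x" for x
  have nz: "n x \<noteq> 0" "d x \<noteq> 0" "q x \<noteq> 0"
    and eq: "ln ((q x)\<^sup>2) = \<alpha> * (ln ((n x)\<^sup>2) - ln ((d x)\<^sup>2) - ln (r\<^sup>2))"
    if x: "x \<in> {-1<..<1}" for x
  proof -
    have f: "f x = n x / (r * d x)" by (simp add: f_def n_def d_def)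
    have f_pow: "rpow_defined (f x) \<alpha>" and "f x \<noteq> 0" and q: "rpow (f x) \<alpha> = q x"
      using assms(5)[of x] x by (auto simp: f_def q_def rpow_defined_def)
    then show nd: "n x \<noteq> 0" "d x \<noteq> 0" by (auto simp: f)
    have aq: "\<bar>q x\<bar> = \<bar>f x\<bar> powr \<alpha>"
      using abs_rpow[OF f_pow] q by simp
    then show "q x \<noteq> 0" using \<open>f x \<noteq> 0\<close> by auto
    have ln_sq: "ln (y\<^sup>2) = 2 * ln \<bar>y\<bar>" if "y \<noteq> 0" for y :: real
      using that ln_realpow[of "\<bar>y\<bar>" 2] by simp
    have "ln \<bar>q x\<bar> = \<alpha> * ln \<bar>f x\<bar>"
      using aq \<open>f x \<noteq> 0\<close> by (simp add: ln_powr)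
    also have "ln \<bar>f x\<bar> = ln \<bar>n x\<bar> - ln \<bar>d x\<bar> - ln \<bar>r\<bar>"
      using nd assms(2) by (simp add: f abs_divide abs_mult ln_div ln_mult)
    finally show "ln ((q x)\<^sup>2) = \<alpha> * (ln ((n x)\<^sup>2) - ln ((d x)\<^sup>2) - ln (r\<^sup>2))"
      using nd \<open>q x \<noteq> 0\<close> assms(2) by (simp add: ln_sq algebra_simps)
  qed
  have poly: "C * (n x * d x) = - \<alpha> * \<kappa> * S * q x" if x: "x \<in> {-1<..<1}" for x
  proof -
    note nzx = nz[OF x]
    have q: "(q has_real_derivative C) (at x)"
      unfolding q_def by (auto intro!: derivative_eq_intros)
    have n: "(n has_real_derivative \<kappa>) (at x)"
      unfolding n_def by (auto intro!: derivative_eq_intros)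
    have d: "(d has_real_derivative r * \<kappa>) (at x)"
      unfolding d_def by (auto intro!: derivative_eq_intros n)
    have "((\<lambda>x. \<alpha> * (ln ((n x)\<^sup>2) - ln ((d x)\<^sup>2) - ln (r\<^sup>2))) has_real_derivative
        \<alpha> * (2 * \<kappa> / n x - 2 * (r * \<kappa>) / d x - 0)) (at x)"
      by (intro DERIV_cmult DERIV_diff DERIV_ln_square n d nzx DERIV_const)
    then have "((\<lambda>x. ln ((q x)\<^sup>2)) has_real_derivative
        \<alpha> * (2 * \<kappa> / n x - 2 * (r * \<kappa>) / d x - 0)) (at x)"
      by (rule has_field_derivative_transform_within_open[of _ _ _ "{-1<..<1}"])
         (use x eq in auto)
    then have "2 * C / q x = \<alpha> * (2 * \<kappa> / n x - 2 * (r * \<kappa>) / d x - 0)"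
      by (rule DERIV_unique[OF DERIV_ln_square[OF q nzx(3)]])
    also have "2 * \<kappa> / n x - 2 * (r * \<kappa>) / d x - 0 = 2 * (\<kappa> * (d x - r * n x)) / (n x * d x)"
      using nzx by (simp add: diff_frac_eq algebra_simps)
    finally have "C * (n x * d x) = \<alpha> * (\<kappa> * (d x - r * n x)) * q x"
      using nzx by (simp add: frac_eq_eq)
    then show ?thesis by (simp add: d_def)
  qed
  define g where "g x = C * ((u + \<kappa> * x) * (r * (u + \<kappa> * x) - S))" for x
  have g: "g x = - \<alpha> * \<kappa> * S * (A + C * x)" if "x \<in> {-1<..<1}" for x
    using poly[OF that] by (simp add: n_def d_def q_def g_def)
  \<comment> \<open>A second difference extracts the coefficient at \<open>x\<^sup>2\<close>; it annihilates affine functions.\<close>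
  have "C * (\<kappa>\<^sup>2 * r) = 2 * (g (1/2) + g (-1/2) - 2 * g 0)"
    by (simp add: g_def power2_eq_square field_simps)
  also have "\<dots> = 0"
    by (simp add: g algebra_simps)
  finally have "C = 0" using assms by simp
  then show False
    using g[of 0] nz(3)[of 0] assms by (simp add: q_def g_def)
qed


section \<open>Orthonormal frames\<close>

lemma frame_orthogonal_transformation:
  fixes N B V :: "real^3"
  assumes "norm V = 1" "norm N = 1" "norm B = 1" "V \<bullet> N = 0" "V \<bullet> B = 0" "N \<bullet> B = 0"
  shows "orthogonal_transformation (\<lambda>x::real^3. x$1 *\<^sub>R N + x$2 *\<^sub>R B + x$3 *\<^sub>R V)"
proof -
  have [simp]: "V \<bullet> V = 1" "N \<bullet> N = 1" "B \<bullet> B = 1" "N \<bullet> V = 0" "B \<bullet> V = 0" "B \<bullet> N = 0"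
    using assms by (simp_all add: norm_eq_1 inner_commute)
  show ?thesis
    unfolding orthogonal_transformation_def
  proof
    show "linear (\<lambda>x::real^3. x$1 *\<^sub>R N + x$2 *\<^sub>R B + x$3 *\<^sub>R V)"
      by (rule linearI) (simp_all add: algebra_simps)
    show "\<forall>v w::real^3. (v$1 *\<^sub>R N + v$2 *\<^sub>R B + v$3 *\<^sub>R V) \<bullet>
        (w$1 *\<^sub>R N + w$2 *\<^sub>R B + w$3 *\<^sub>R V) = v \<bullet> w"
      by (simp add: inner_add_left inner_add_right assms)
         (simp add: inner_vec_def sum_3)
  qed
qed

text \<open>
  The map built from the frame is an isometry of \<open>\<real>\<^sup>3\<close>, hence onto, so \<open>w\<close> has coordinates in the
  frame; two of them vanish.
\<close>

lemma unit_vector_orthogonal_to_two: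
  fixes T N B w :: "real^3"
  assumes "norm T = 1" "norm N = 1" "norm B = 1" "T \<bullet> N = 0" "T \<bullet> B = 0" "N \<bullet> B = 0"
    and "norm w = 1" "N \<bullet> w = 0" "B \<bullet> w = 0"
  shows "w = T \<or> w = - T"
proof -
  let ?F = "\<lambda>x::real^3. x$1 *\<^sub>R N + x$2 *\<^sub>R B + x$3 *\<^sub>R T"
  have F: "orthogonal_transformation ?F"
    using assms by (intro frame_orthogonal_transformation)
  obtain x where w: "w = ?F x"
    using orthogonal_transformation_surj[OF F] by (meson surjD)
  have "x$1 = 0" "x$2 = 0"
    using assms by (simp_all add: w inner_add_right norm_eq_1 inner_commute)
  then have "w = (x$3) *\<^sub>R T" by (simp add: w)
  moreover from this have "\<bar>x$3\<bar> = 1" using assms by simp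
  ultimately show ?thesis by (auto simp: abs_if split: if_splits)
qed


section \<open>The Gauss curvature of a canal surface\<close>

text \<open>
  The second-form determinant factors as \<open>det (dU) * det (dX)\<close> and the first-form determinant as
  \<open>det (dX)\<^sup>2\<close>, so the quotient is \<open>det (dU) / det (dX)\<close> in coordinates with respect to \<open>e\<^sub>1\<close>, \<open>e\<^sub>2\<close>. Both
  matrices are triangular here because the \<open>\<theta>\<close>-derivatives are multiples of \<open>e\<^sub>2\<close>. When \<open>m = 0\<close>, both
  sides are a division by zero.
\<close>

lemma gauss_quotient_orthonormal:
  fixes e\<^sub>1 e\<^sub>2 :: "'a::real_inner" and a b m r S :: real
  assumes "norm e\<^sub>1 = 1" "norm e\<^sub>2 = 1" "e\<^sub>1 \<bullet> e\<^sub>2 = 0" "r \<noteq> 0" "S \<noteq> 0"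
    and "Us = a *\<^sub>R e\<^sub>1 + b *\<^sub>R e\<^sub>2" "Xs = m *\<^sub>R e\<^sub>1 + (r * b) *\<^sub>R e\<^sub>2"
    and "Ut = S *\<^sub>R e\<^sub>2" "Xt = (r * S) *\<^sub>R e\<^sub>2"
  shows "((Us \<bullet> Xs) * (Ut \<bullet> Xt) - (Us \<bullet> Xt) * (Ut \<bullet> Xs)) /
         ((Xs \<bullet> Xs) * (Xt \<bullet> Xt) - (Xs \<bullet> Xt)\<^sup>2) = a / (r * m)"
proof -
  have e: "e\<^sub>1 \<bullet> e\<^sub>1 = 1" "e\<^sub>2 \<bullet> e\<^sub>2 = 1" "e\<^sub>2 \<bullet> e\<^sub>1 = 0"
    using assms by (simp_all add: norm_eq_1 inner_commute)
  have "(Us \<bullet> Xs) * (Ut \<bullet> Xt) - (Us \<bullet> Xt) * (Ut \<bullet> Xs) = a * (r * m * S\<^sup>2)"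
    by (simp add: assms e inner_add_left inner_add_right) (simp add: power2_eq_square algebra_simps)
  moreover have "(Xs \<bullet> Xs) * (Xt \<bullet> Xt) - (Xs \<bullet> Xt)\<^sup>2 = (r * m) * (r * m * S\<^sup>2)"
    by (simp add: assms e inner_add_left inner_add_right) (simp add: power2_eq_square algebra_simps)
  ultimately show ?thesis
    using assms(4,5) by simp
qed

lemma canal_param_eq: "canal_param c r \<phi> T N B s \<theta> = c s + r s *\<^sub>R canal_normal \<phi> T N B s \<theta>"
  by (simp add: canal_param_def canal_normal_def)

context
  fixes l :: real and c T N B :: "real \<Rightarrow> real^3" and r \<phi> \<kappa> \<tau> :: "real \<Rightarrow> real"
  assumes canal: "canal_surface l c r \<phi> T N B \<kappa> \<tau>"
begin

lemma canal_frame: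
  assumes "s \<in> {0..l}"
  shows "norm (T s) = 1" "norm (N s) = 1" "norm (B s) = 1"
    "T s \<bullet> N s = 0" "T s \<bullet> B s = 0" "N s \<bullet> B s = 0"
    "(c has_vector_derivative T s) (at s within {0..l})"
    "(T has_vector_derivative \<kappa> s *\<^sub>R N s) (at s within {0..l})"
    "(N has_vector_derivative - \<kappa> s *\<^sub>R T s + \<tau> s *\<^sub>R B s) (at s within {0..l})"
    "(B has_vector_derivative - \<tau> s *\<^sub>R N s) (at s within {0..l})"
    "0 < r s" "(r has_vector_derivative - cos (\<phi> s)) (at s within {0..l})"
  using canal assms unfolding canal_surface_def frenet_frame_def by blast+

lemma canal_length_pos: "0 < l"
  using canal by (simp add: canal_surface_def)

lemma pd2_canal_normal:
  assumes "\<theta> \<in> {0..<2*pi}"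
  shows "pd2 {0..<2*pi} (canal_normal \<phi> T N B) s \<theta> =
    sin (\<phi> s) *\<^sub>R (- sin \<theta> *\<^sub>R N s + cos \<theta> *\<^sub>R B s)"
  unfolding pd2_def canal_normal_def
  by (rule deriv_on_Ico_2pi[OF _ assms])
     (auto intro!: derivative_eq_intros simp: algebra_simps)

lemma pd2_canal_param:
  assumes "\<theta> \<in> {0..<2*pi}"
  shows "pd2 {0..<2*pi} (canal_param c r \<phi> T N B) s \<theta> =
    (r s * sin (\<phi> s)) *\<^sub>R (- sin \<theta> *\<^sub>R N s + cos \<theta> *\<^sub>R B s)"
  unfolding pd2_def canal_param_def
  by (rule deriv_on_Ico_2pi[OF _ assms])
     (auto intro!: derivative_eq_intros simp: algebra_simps)

lemma sin_canal_nonzero: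
  assumes "s \<in> {0..l}"
  shows "sin (\<phi> s) \<noteq> 0"
proof
  assume "sin (\<phi> s) = 0"
  then have "pd2 {0..<2*pi} (canal_param c r \<phi> T N B) s 0 = 0"
    by (subst pd2_canal_param) auto
  moreover have "cross3 (pd1 {0..l} (canal_param c r \<phi> T N B) s 0)
      (pd2 {0..<2*pi} (canal_param c r \<phi> T N B) s 0) \<noteq> 0"
    using canal assms unfolding canal_surface_def regular_patch_def by auto
  ultimately show False by simp
qed

text \<open>
  The derivative is expressed in the orthonormal basis of the tangent plane that consists of the
  direction orthogonal to the circle and the direction along it. In this form the factor that vanishes
  with the curvature, \<open>p + \<kappa> cos \<theta>\<close>, is isolated as the first component.
\<close>

lemma canal_normal_derivative:
  fixes \<theta> :: real
  assumes s: "s \<in> {0..l}"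
    and p: "(\<phi> has_vector_derivative p) (at s within {0..l})"
  shows "((\<lambda>t. canal_normal \<phi> T N B t \<theta>) has_vector_derivative
     (- (p + \<kappa> s * cos \<theta>)) *\<^sub>R
       (sin (\<phi> s) *\<^sub>R T s - cos (\<phi> s) *\<^sub>R (cos \<theta> *\<^sub>R N s + sin \<theta> *\<^sub>R B s)) +
     (\<tau> s * sin (\<phi> s) - \<kappa> s * cos (\<phi> s) * sin \<theta>) *\<^sub>R (- sin \<theta> *\<^sub>R N s + cos \<theta> *\<^sub>R B s))
     (at s within {0..l})" (is "(_ has_vector_derivative ?D) _")
proof -
  note fr = canal_frame[OF s]
  have p': "(\<phi> has_real_derivative p) (at s within {0..l})"
    using p by (simp add: has_real_derivative_iff_has_vector_derivative)
  have "((\<lambda>t. canal_normal \<phi> T N B t \<theta>) has_vector_derivative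
     (cos (\<phi> s) *\<^sub>R (\<kappa> s *\<^sub>R N s) + (- sin (\<phi> s) * p) *\<^sub>R T s +
     ((sin (\<phi> s) * cos \<theta>) *\<^sub>R (- \<kappa> s *\<^sub>R T s + \<tau> s *\<^sub>R B s) + (cos (\<phi> s) * p * cos \<theta>) *\<^sub>R N s) +
     ((sin (\<phi> s) * sin \<theta>) *\<^sub>R (- \<tau> s *\<^sub>R N s) + (cos (\<phi> s) * p * sin \<theta>) *\<^sub>R B s)))
     (at s within {0..l})" (is "(_ has_vector_derivative ?E) _")
    unfolding canal_normal_def
    by (intro has_vector_derivative_add has_vector_derivative_scaleR fr)
       (auto intro!: derivative_eq_intros p')
  moreover have "?E = ?D"
  proof -
    have sc: "cos \<theta> * cos \<theta> = 1 - sin \<theta> * sin \<theta>"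
      using sin_cos_squared_add[of \<theta>] by (simp add: power2_eq_square)
    have 1: "cos (\<phi> s) * \<kappa> s + cos (\<phi> s) * p * cos \<theta> - sin (\<phi> s) * sin \<theta> * \<tau> s =
       (p + \<kappa> s * cos \<theta>) * cos (\<phi> s) * cos \<theta> -
       (\<tau> s * sin (\<phi> s) - \<kappa> s * cos (\<phi> s) * sin \<theta>) * sin \<theta>"
      using sc by algebra
    have 2: "sin (\<phi> s) * cos \<theta> * \<tau> s + cos (\<phi> s) * p * sin \<theta> =
       (p + \<kappa> s * cos \<theta>) * cos (\<phi> s) * sin \<theta> +
       (\<tau> s * sin (\<phi> s) - \<kappa> s * cos (\<phi> s) * sin \<theta>) * cos \<theta>"
      by (simp add: algebra_simps)
    have "?E = (- (p + \<kappa> s * cos \<theta>) * sin (\<phi> s)) *\<^sub>R T s +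
       (cos (\<phi> s) * \<kappa> s + cos (\<phi> s) * p * cos \<theta> - sin (\<phi> s) * sin \<theta> * \<tau> s) *\<^sub>R N s +
       (sin (\<phi> s) * cos \<theta> * \<tau> s + cos (\<phi> s) * p * sin \<theta>) *\<^sub>R B s"
      by (simp add: algebra_simps)
    also have "\<dots> = ?D"
      unfolding 1 2 by (simp add: algebra_simps)
    finally show ?thesis .
  qed
  ultimately show ?thesis by simp
qed

lemma gauss_curvature_canal:
  assumes s: "s \<in> {0..l}" and \<theta>: "\<theta> \<in> {0..<2*pi}"
    and p: "(\<phi> has_vector_derivative p) (at s within {0..l})"
  shows "gauss_curvature {0..l} {0..<2*pi} (canal_param c r \<phi> T N B) (canal_normal \<phi> T N B) s \<theta> =
    (p + \<kappa> s * cos \<theta>) / (r s * (r s * (p + \<kappa> s * cos \<theta>) - sin (\<phi> s)))"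
proof -
  note fr = canal_frame[OF s]
  define e\<^sub>1 where "e\<^sub>1 = sin (\<phi> s) *\<^sub>R T s - cos (\<phi> s) *\<^sub>R (cos \<theta> *\<^sub>R N s + sin \<theta> *\<^sub>R B s)"
  define e\<^sub>2 where "e\<^sub>2 = - sin \<theta> *\<^sub>R N s + cos \<theta> *\<^sub>R B s"
  define a where "a = - (p + \<kappa> s * cos \<theta>)"
  define b where "b = \<tau> s * sin (\<phi> s) - \<kappa> s * cos (\<phi> s) * sin \<theta>"
  let ?U = "canal_normal \<phi> T N B" and ?X = "canal_param c r \<phi> T N B"
  have ip: "T s \<bullet> T s = 1" "N s \<bullet> N s = 1" "B s \<bullet> B s = 1"
    "N s \<bullet> T s = 0" "B s \<bullet> T s = 0" "B s \<bullet> N s = 0"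
    using fr by (simp_all add: norm_eq_1 inner_commute)
  have c2: "cos x * cos x = 1 - sin x * sin x" for x :: real
    using sin_cos_squared_add[of x] by (simp add: power2_eq_square)
  have e1: "norm e\<^sub>1 = 1"
    unfolding norm_eq_1 e\<^sub>1_def
    by (simp add: inner_diff_left inner_diff_right inner_add_left inner_add_right ip fr)
       (use c2[of \<theta>] c2[of "\<phi> s"] in algebra)
  have e2: "norm e\<^sub>2 = 1"
    unfolding norm_eq_1 e\<^sub>2_def
    by (simp add: inner_diff_left inner_diff_right inner_add_left inner_add_right ip fr)
  have e12: "e\<^sub>1 \<bullet> e\<^sub>2 = 0"
    unfolding e\<^sub>1_def e\<^sub>2_def
    by (simp add: inner_diff_left inner_diff_right inner_add_left inner_add_right ip fr)
  have dU: "((\<lambda>t. ?U t \<theta>) has_vector_derivative a *\<^sub>R e\<^sub>1 + b *\<^sub>R e\<^sub>2) (at s within {0..l})"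
    using canal_normal_derivative[OF s p, of \<theta>] by (simp add: a_def b_def e\<^sub>1_def e\<^sub>2_def)
  have r': "(r has_real_derivative - cos (\<phi> s)) (at s within {0..l})"
    using fr by (simp add: has_real_derivative_iff_has_vector_derivative)
  \<comment> \<open>The tangential part of \<open>T\<close> is \<open>sin \<phi>\<close> times \<open>e\<^sub>1\<close>; the normal part cancels against \<open>r' U\<close>.\<close>
  have T: "T s - cos (\<phi> s) *\<^sub>R ?U s \<theta> = sin (\<phi> s) *\<^sub>R e\<^sub>1"
  proof -
    have "(cos (\<phi> s) * cos (\<phi> s)) *\<^sub>R T s + (sin (\<phi> s) * sin (\<phi> s)) *\<^sub>R T s = T s"
      unfolding scaleR_left_distrib[symmetric] by (simp add: c2)
    then show ?thesis
      by (simp add: canal_normal_def e\<^sub>1_def algebra_simps)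
  qed
  have "((\<lambda>t. ?X t \<theta>) has_vector_derivative
      T s + (r s *\<^sub>R (a *\<^sub>R e\<^sub>1 + b *\<^sub>R e\<^sub>2) + (- cos (\<phi> s)) *\<^sub>R ?U s \<theta>)) (at s within {0..l})"
    unfolding canal_param_eq
    by (intro has_vector_derivative_add has_vector_derivative_scaleR fr r' dU)
  also have "T s + (r s *\<^sub>R (a *\<^sub>R e\<^sub>1 + b *\<^sub>R e\<^sub>2) + (- cos (\<phi> s)) *\<^sub>R ?U s \<theta>) =
      (sin (\<phi> s) + r s * a) *\<^sub>R e\<^sub>1 + (r s * b) *\<^sub>R e\<^sub>2"
    using T by (simp add: algebra_simps)
  finally have dX: "((\<lambda>t. ?X t \<theta>) has_vector_derivative
      (sin (\<phi> s) + r s * a) *\<^sub>R e\<^sub>1 + (r s * b) *\<^sub>R e\<^sub>2) (at s within {0..l})" .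
  have "gauss_curvature {0..l} {0..<2*pi} ?X ?U s \<theta> = a / (r s * (sin (\<phi> s) + r s * a))"
    unfolding gauss_curvature_def Let_def
  proof (rule gauss_quotient_orthonormal[OF e1 e2 e12])
    show "pd1 {0..l} ?U s \<theta> = a *\<^sub>R e\<^sub>1 + b *\<^sub>R e\<^sub>2"
      unfolding pd1_def by (rule deriv_on_Icc[OF dU canal_length_pos s])
    show "pd1 {0..l} ?X s \<theta> = (sin (\<phi> s) + r s * a) *\<^sub>R e\<^sub>1 + (r s * b) *\<^sub>R e\<^sub>2"
      unfolding pd1_def by (rule deriv_on_Icc[OF dX canal_length_pos s])
    show "pd2 {0..<2*pi} ?U s \<theta> = sin (\<phi> s) *\<^sub>R e\<^sub>2"
      "pd2 {0..<2*pi} ?X s \<theta> = (r s * sin (\<phi> s)) *\<^sub>R e\<^sub>2"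
      by (simp_all add: pd2_canal_normal[OF \<theta>] pd2_canal_param[OF \<theta>] e\<^sub>2_def)
    show "r s \<noteq> 0" "sin (\<phi> s) \<noteq> 0"
      using fr sin_canal_nonzero[OF s] by auto
  qed
  also have "\<dots> = - a / (r s * (r s * (- a) - sin (\<phi> s)))"
  proof -
    have "r s * (r s * (- a) - sin (\<phi> s)) = - (r s * (sin (\<phi> s) + r s * a))"
      by (simp add: algebra_simps)
    then show ?thesis by simp
  qed
  finally show ?thesis by (simp add: a_def add.commute)
qed

lemma canal_translator_equation:
  assumes "K_translator \<alpha> w {0..l} {0..<2*pi} (canal_param c r \<phi> T N B) (canal_normal \<phi> T N B)"
    and s: "s \<in> {0..l}" and \<theta>: "\<theta> \<in> {0..<2*pi}"
    and p: "(\<phi> has_vector_derivative p) (at s within {0..l})"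
    and K: "K = (p + \<kappa> s * cos \<theta>) / (r s * (r s * (p + \<kappa> s * cos \<theta>) - sin (\<phi> s)))"
  shows "rpow_defined K \<alpha>"
    "rpow K \<alpha> = cos (\<phi> s) * (T s \<bullet> w) + sin (\<phi> s) * cos \<theta> * (N s \<bullet> w) + sin (\<phi> s) * sin \<theta> * (B s \<bullet> w)"
proof -
  have "K = gauss_curvature {0..l} {0..<2*pi} (canal_param c r \<phi> T N B) (canal_normal \<phi> T N B) s \<theta>"
    by (simp add: K gauss_curvature_canal[OF s \<theta> p])
  then have "rpow_defined K \<alpha> \<and> rpow K \<alpha> = canal_normal \<phi> T N B s \<theta> \<bullet> w"
    using assms(1) s \<theta> unfolding K_translator_def by blast
  then show "rpow_defined K \<alpha>" and
    "rpow K \<alpha> = cos (\<phi> s) * (T s \<bullet> w) + sin (\<phi> s) * cos \<theta> * (N s \<bullet> w) + sin (\<phi> s) * sin \<theta> * (B s \<bullet> w)"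
    by (auto simp: canal_normal_def inner_add_left)
qed

text \<open>
  At \<open>\<theta> = \<pi>/2\<close> and \<open>\<theta> = 3\<pi>/2\<close> the curvature is the same because \<open>cos \<theta> = 0\<close> at both, while the
  \<open>B\<close>-term of \<open>\<langle>U, w\<rangle>\<close> changes sign. Once it is gone, both sides of the translator equation are
  functions of \<open>cos \<theta>\<close> and the statement on powers of linear fractional functions applies. After
  \<open>\<kappa> s = 0\<close> is known, the \<open>N\<close>-term is treated by the points \<open>\<theta> = 0\<close> and \<open>\<theta> = \<pi>\<close>.
\<close>

lemma canal_translator_pointwise:
  assumes \<alpha>: "\<alpha> \<noteq> 0"
    and tr: "K_translator \<alpha> w {0..l} {0..<2*pi} (canal_param c r \<phi> T N B) (canal_normal \<phi> T N B)"
    and s: "s \<in> {0..l}"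
  shows "\<kappa> s = 0" "N s \<bullet> w = 0" "B s \<bullet> w = 0"
proof -
  obtain p where p: "(\<phi> has_vector_derivative p) (at s within {0..l})"
    using canal smooth_on_has_derivative[OF _ s] unfolding canal_surface_def by blast
  note eqn = canal_translator_equation[OF tr s _ p refl]
  note S = sin_canal_nonzero[OF s]
  have "sin (3 * pi / 2) = -1" "cos (3 * pi / 2) = 0"
    using sin_3over2_pi cos_3over2_pi by (simp_all add: field_simps)
  then show Bw: "B s \<bullet> w = 0"
    using eqn(2)[of "pi/2"] eqn(2)[of "3*pi/2"] S by simp
  show \<kappa>: "\<kappa> s = 0"
  proof (rule ccontr)
    assume "\<kappa> s \<noteq> 0"
    show False
    proof (rule rpow_moebius_not_affine[OF \<alpha> _ \<open>\<kappa> s \<noteq> 0\<close> S])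
      show "r s \<noteq> 0" using canal_frame[OF s] by simp
      fix x :: real
      assume x: "-1 < x" "x < 1"
      have "arccos x \<in> {0..<2*pi}"
        using arccos_bounded[of x] x pi_gt_zero by (auto intro: le_less_trans[of _ pi])
      then show "rpow_defined ((p + \<kappa> s * x) / (r s * (r s * (p + \<kappa> s * x) - sin (\<phi> s)))) \<alpha> \<and>
          rpow ((p + \<kappa> s * x) / (r s * (r s * (p + \<kappa> s * x) - sin (\<phi> s)))) \<alpha> =
          cos (\<phi> s) * (T s \<bullet> w) + sin (\<phi> s) * (N s \<bullet> w) * x"
        using eqn[of "arccos x"] x Bw by (simp add: cos_arccos mult_ac)
    qed
  qed
  show "N s \<bullet> w = 0"
    using eqn(2)[of 0] eqn(2)[of pi] S \<kappa> by simp
qed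

end


section \<open>The surface of revolution\<close>

text \<open>
  Since \<open>r'' = p sin \<phi>\<close> and \<open>1 - r'\<^sup>2 = sin\<^sup>2 \<phi>\<close>, the base of the power in the radius equation is the
  curvature of the canal surface with \<open>\<kappa> = 0\<close>, up to a common factor \<open>sin \<phi>\<close>. The lemma is
  about the functions \<open>r\<close> and \<open>\<phi>\<close> alone so as to serve for both orientations of the spine.
\<close>

lemma radius_equationI:
  fixes r \<phi> :: "real \<Rightarrow> real"
  assumes l: "0 < l"
    and r': "\<And>s. s \<in> {0..l} \<Longrightarrow> (r has_vector_derivative - cos (\<phi> s)) (at s within {0..l})"
    and S: "\<And>s. s \<in> {0..l} \<Longrightarrow> sin (\<phi> s) \<noteq> 0"
    and eqn: "\<And>s. s \<in> {0..l} \<Longrightarrow> \<exists>p. (\<phi> has_vector_derivative p) (at s within {0..l}) \<and>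
       rpow_defined (p / (r s * (r s * p - sin (\<phi> s)))) \<alpha> \<and>
       rpow (p / (r s * (r s * p - sin (\<phi> s)))) \<alpha> = cos (\<phi> s)"
  shows "radius_equation \<alpha> {0..l} r"
  unfolding radius_equation_def Let_def
proof
  fix s assume s: "s \<in> {0..l}"
  obtain p where p: "(\<phi> has_vector_derivative p) (at s within {0..l})"
    and K: "rpow_defined (p / (r s * (r s * p - sin (\<phi> s)))) \<alpha>"
       "rpow (p / (r s * (r s * p - sin (\<phi> s)))) \<alpha> = cos (\<phi> s)"
    using eqn[OF s] by blast
  have d1: "deriv_on {0..l} r t = - cos (\<phi> t)" if "t \<in> {0..l}" for t
    using deriv_on_Icc[OF r'[OF that] l that] .
  have cos': "((\<lambda>t. - cos (\<phi> t)) has_vector_derivative sin (\<phi> s) * p) (at s within {0..l})"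
    using p unfolding has_real_derivative_iff_has_vector_derivative[symmetric]
    by (auto intro!: derivative_eq_intros)
  have "(deriv_on {0..l} r has_vector_derivative sin (\<phi> s) * p) (at s within {0..l})"
    by (rule has_vector_derivative_transform[OF s _ cos']) (rule d1)
  then have d2: "deriv_on {0..l} (deriv_on {0..l} r) s = sin (\<phi> s) * p"
    by (rule deriv_on_Icc[OF _ l s])
  have "r s * (r s * (sin (\<phi> s) * p) - 1 + (- cos (\<phi> s))\<^sup>2) =
      sin (\<phi> s) * (r s * (r s * p - sin (\<phi> s)))"
    using sin_cos_squared_add[of "\<phi> s"] by algebra
  then have "sin (\<phi> s) * p / (r s * (r s * (sin (\<phi> s) * p) - 1 + (- cos (\<phi> s))\<^sup>2)) =
      sin (\<phi> s) * p / (sin (\<phi> s) * (r s * (r s * p - sin (\<phi> s))))"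
    by (rule arg_cong)
  also have "\<dots> = p / (r s * (r s * p - sin (\<phi> s)))"
    by (rule mult_divide_mult_cancel_left[OF S[OF s]])
  finally show "rpow_defined (deriv_on {0..l} (deriv_on {0..l} r) s /
      (r s * (r s * deriv_on {0..l} (deriv_on {0..l} r) s - 1 + (deriv_on {0..l} r s)\<^sup>2))) \<alpha> \<and>
    rpow (deriv_on {0..l} (deriv_on {0..l} r) s /
      (r s * (r s * deriv_on {0..l} (deriv_on {0..l} r) s - 1 + (deriv_on {0..l} r s)\<^sup>2))) \<alpha> =
    - deriv_on {0..l} r s"
    unfolding d2 d1[OF s] using K by (simp only: minus_minus)
qed

lemma has_vector_derivative_reverse:
  fixes f :: "real \<Rightarrow> 'a::real_normed_vector"
  assumes "(f has_vector_derivative f') (at (l - s) within {0..l})"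
  shows "((\<lambda>t. f (l - t)) has_vector_derivative - f') (at s within {0..l})"
proof -
  have "((\<lambda>t. l - t) has_vector_derivative -1) (at s within {0..l})"
    by (auto intro!: derivative_eq_intros)
  moreover have "(\<lambda>t. l - t) ` {0..l} = {0..l}"
    by simp
  ultimately show ?thesis
    using vector_diff_chain_within[of "\<lambda>t. l - t" "-1" s "{0..l}" f f'] assms
    by (simp add: o_def)
qed

lemma frenet_frame_straight:
  assumes "frenet_frame {0..l} c T N B \<kappa> \<tau>" and "0 < l" and "\<And>s. s \<in> {0..l} \<Longrightarrow> \<kappa> s = 0"
    and s: "s \<in> {0..l}"
  shows "T s = T 0" "N s = N 0" "B s = B 0" "c s = c 0 + s *\<^sub>R T 0"
proof -
  have "0 \<in> {0..l}" using \<open>0 < l\<close> by simp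
  moreover have "\<forall>s\<in>{0..l}. \<forall>t\<in>{0..l}. T s = T t \<and> N s = N t \<and> B s = B t"
    using assms(1,3) unfolding frenet_frame_def by blast
  ultimately have const: "T t = T 0" "N t = N 0" "B t = B 0" if "t \<in> {0..l}" for t
    using that by blast+
  show "T s = T 0" "N s = N 0" "B s = B 0" by (rule const[OF s])+
  have "((\<lambda>t. c t - t *\<^sub>R T 0) has_vector_derivative 0) (at t within {0..l})"
    if t: "t \<in> {0..l}" for t
  proof -
    have "(c has_vector_derivative T 0) (at t within {0..l})"
      using assms(1) t const(1)[OF t] unfolding frenet_frame_def by metis
    then show ?thesis
      by (auto intro!: derivative_eq_intros)
  qed
  then obtain p where p: "\<And>t. t \<in> {0..l} \<Longrightarrow> c t - t *\<^sub>R T 0 = p"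
    using has_vector_derivative_zero_constant[of "{0..l}" "\<lambda>t. c t - t *\<^sub>R T 0"] by auto
  from p[of 0] p[OF s] \<open>0 < l\<close> show "c s = c 0 + s *\<^sub>R T 0"
    by (simp add: algebra_simps)
qed

theorem theorem6:
  fixes \<alpha> l :: real and w :: "real^3"
    and c T N B :: "real \<Rightarrow> real^3" and r \<phi> \<kappa> \<tau> :: "real \<Rightarrow> real"
  assumes "\<alpha> \<noteq> 0" and "norm w = 1"
    and "canal_surface l c r \<phi> T N B \<kappa> \<tau>"
    and "K_translator \<alpha> w {0..l} {0..<2*pi} (canal_param c r \<phi> T N B) (canal_normal \<phi> T N B)"
  shows "(\<exists>p v. norm v = 1 \<and> (\<forall>s\<in>{0..l}. c s = p + s *\<^sub>R v)) \<and>
    (\<exists>\<sigma> c\<^sub>1 r\<^sub>1 \<phi>\<^sub>1 p F.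
       reoriented l c r \<phi> \<sigma> c\<^sub>1 r\<^sub>1 \<phi>\<^sub>1 \<and>
       orthogonal_transformation F \<and>
       (\<forall>s\<in>{0..l}. c\<^sub>1 s = p + F (vector [0, 0, s])) \<and>
       (\<forall>s\<in>{0..l}. \<forall>\<theta>\<in>{0..<2*pi}.
          canal_param c r \<phi> T N B (\<sigma> s) \<theta> = p + F (revolution_param r\<^sub>1 \<phi>\<^sub>1 s \<theta>)) \<and>
       (\<forall>s\<in>{0..l}. (r\<^sub>1 has_vector_derivative - cos (\<phi>\<^sub>1 s)) (at s within {0..l})) \<and>
       radius_equation \<alpha> {0..l} r\<^sub>1 \<and>
       (\<forall>s\<in>{0..l}. (c\<^sub>1 has_vector_derivative w) (at s within {0..l})))"
proof -
  note canal = assms(3)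
  note fr = canal_frame[OF canal]
  note S = sin_canal_nonzero[OF canal]
  have l: "0 < l" and frenet: "frenet_frame {0..l} c T N B \<kappa> \<tau>" and sm: "smooth_on {0..l} \<phi>"
    using canal by (auto simp: canal_surface_def)
  have 0: "0 \<in> {0..l}" using l by simp
  note pw = canal_translator_pointwise[OF canal assms(1,4)]
  have straight: "T s = T 0" "N s = N 0" "B s = B 0" "c s = c 0 + s *\<^sub>R T 0"
    if "s \<in> {0..l}" for s
    using frenet_frame_straight[OF frenet l _ that] pw(1) by blast+
  have eqn: "\<exists>p. (\<phi> has_vector_derivative p) (at s within {0..l}) \<and>
       rpow_defined (p / (r s * (r s * p - sin (\<phi> s)))) \<alpha> \<and>
       rpow (p / (r s * (r s * p - sin (\<phi> s)))) \<alpha> = cos (\<phi> s) * (T 0 \<bullet> w)"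
    if s: "s \<in> {0..l}" for s
  proof -
    obtain p where p: "(\<phi> has_vector_derivative p) (at s within {0..l})"
      using smooth_on_has_derivative[OF sm s] .
    show ?thesis
      using canal_translator_equation[OF canal assms(4) s _ p, of 0] pw[OF s] p straight(1)[OF s]
      by auto
  qed
  have "\<exists>p v. norm v = 1 \<and> (\<forall>s\<in>{0..l}. c s = p + s *\<^sub>R v)"
    using straight(4) fr(1)[OF 0] by blast
  moreover have "w = T 0 \<or> w = - T 0"
    by (rule unit_vector_orthogonal_to_two[OF fr(1-6)[OF 0] assms(2) pw(2,3)[OF 0]])
  then have "\<exists>\<sigma> c\<^sub>1 r\<^sub>1 \<phi>\<^sub>1 p F.
       reoriented l c r \<phi> \<sigma> c\<^sub>1 r\<^sub>1 \<phi>\<^sub>1 \<and>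
       orthogonal_transformation F \<and>
       (\<forall>s\<in>{0..l}. c\<^sub>1 s = p + F (vector [0, 0, s])) \<and>
       (\<forall>s\<in>{0..l}. \<forall>\<theta>\<in>{0..<2*pi}.
          canal_param c r \<phi> T N B (\<sigma> s) \<theta> = p + F (revolution_param r\<^sub>1 \<phi>\<^sub>1 s \<theta>)) \<and>
       (\<forall>s\<in>{0..l}. (r\<^sub>1 has_vector_derivative - cos (\<phi>\<^sub>1 s)) (at s within {0..l})) \<and>
       radius_equation \<alpha> {0..l} r\<^sub>1 \<and>
       (\<forall>s\<in>{0..l}. (c\<^sub>1 has_vector_derivative w) (at s within {0..l}))"
  proof
    assume w: "w = T 0"
    let ?F = "\<lambda>x::real^3. x$1 *\<^sub>R N 0 + x$2 *\<^sub>R B 0 + x$3 *\<^sub>R T 0"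
    show ?thesis
    proof (intro exI conjI ballI)
      show "reoriented l c r \<phi> (\<lambda>s. s) c r \<phi>"
        by (simp add: reoriented_def)
      show "orthogonal_transformation ?F"
        by (rule frame_orthogonal_transformation) (use fr[OF 0] in auto)
      show "c s = c 0 + ?F (vector [0, 0, s])" if "s \<in> {0..l}" for s
        using straight(4)[OF that] by simp
      show "canal_param c r \<phi> T N B s \<theta> = c 0 + ?F (revolution_param r \<phi> s \<theta>)"
        if "s \<in> {0..l}" for s \<theta>
        using straight[OF that] by (simp add: canal_param_def revolution_param_def algebra_simps)
      show "(r has_vector_derivative - cos (\<phi> s)) (at s within {0..l})" if "s \<in> {0..l}" for s
        using fr(12)[OF that] .
      show "radius_equation \<alpha> {0..l} r"
        using eqn fr(1)[OF 0] w by (intro radius_equationI[OF l fr(12) S]) (auto simp: norm_eq_1)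
      show "(c has_vector_derivative w) (at s within {0..l})" if "s \<in> {0..l}" for s
        using fr(7)[OF that] straight(1)[OF that] w by simp
    qed
  next
    assume w: "w = - T 0"
    \<comment> \<open>Reversing the spine turns its tangent into \<open>- T = w\<close>; the frame \<open>N\<close>, \<open>B\<close> is kept, which
      changes the orientation but leaves the map orthogonal.\<close>
    let ?F = "\<lambda>x::real^3. x$1 *\<^sub>R N 0 + x$2 *\<^sub>R B 0 + x$3 *\<^sub>R (- T 0)"
    have rev: "l - s \<in> {0..l}" if "s \<in> {0..l}" for s
      using that by simp
    have Tw: "T 0 \<bullet> w = -1"
      using fr(1)[OF 0] w by (simp add: norm_eq_1)
    have cl: "c l = c 0 + l *\<^sub>R T 0"
      using straight(4)[of l] l by simp
    show ?thesis
    proof (intro exI conjI ballI)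
      show "reoriented l c r \<phi> (\<lambda>s. l - s) (\<lambda>s. c (l - s)) (\<lambda>s. r (l - s)) (\<lambda>s. pi - \<phi> (l - s))"
        by (simp add: reoriented_def)
      show "orthogonal_transformation ?F"
        by (rule frame_orthogonal_transformation) (use fr[OF 0] in auto)
      show "c (l - s) = c l + ?F (vector [0, 0, s])" if "s \<in> {0..l}" for s
        using straight(4)[OF rev[OF that]] cl by (simp add: algebra_simps)
      show "canal_param c r \<phi> T N B (l - s) \<theta> =
          c l + ?F (revolution_param (\<lambda>s. r (l - s)) (\<lambda>s. pi - \<phi> (l - s)) s \<theta>)"
        if "s \<in> {0..l}" for s \<theta>
        using straight[OF rev[OF that]] cl
        by (simp add: canal_param_def revolution_param_def algebra_simps)
      show r': "((\<lambda>s. r (l - s)) has_vector_derivative - cos (pi - \<phi> (l - s))) (at s within {0..l})"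
        if "s \<in> {0..l}" for s
        using has_vector_derivative_reverse[OF fr(12)[OF rev[OF that]]] by simp
      show "radius_equation \<alpha> {0..l} (\<lambda>s. r (l - s))"
      proof (rule radius_equationI[OF l r'])
        fix s assume s: "s \<in> {0..l}"
        show "sin (pi - \<phi> (l - s)) \<noteq> 0"
          using S[OF rev[OF s]] by simp
        obtain p where p: "(\<phi> has_vector_derivative p) (at (l - s) within {0..l})"
          and K: "rpow_defined (p / (r (l - s) * (r (l - s) * p - sin (\<phi> (l - s))))) \<alpha>"
            "rpow (p / (r (l - s) * (r (l - s) * p - sin (\<phi> (l - s))))) \<alpha> = - cos (\<phi> (l - s))"
          using eqn[OF rev[OF s]] Tw by auto
        have "((\<lambda>s. pi - \<phi> (l - s)) has_vector_derivative p) (at s within {0..l})"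
          using has_vector_derivative_diff[OF has_vector_derivative_const
              has_vector_derivative_reverse[OF p], of pi] by simp
        then show "\<exists>p. ((\<lambda>s. pi - \<phi> (l - s)) has_vector_derivative p) (at s within {0..l}) \<and>
            rpow_defined (p / (r (l - s) * (r (l - s) * p - sin (pi - \<phi> (l - s))))) \<alpha> \<and>
            rpow (p / (r (l - s) * (r (l - s) * p - sin (pi - \<phi> (l - s))))) \<alpha> =
              cos (pi - \<phi> (l - s))"
          using K by auto
      qed
      show "((\<lambda>s. c (l - s)) has_vector_derivative w) (at s within {0..l})"
        if "s \<in> {0..l}" for s
        using has_vector_derivative_reverse[OF fr(7)[OF rev[OF that]]] straight(1)[OF rev[OF that]] w
        by simp
    qed
  qed
  ultimately show ?thesis by blast
qed

end
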